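(* The space $\operatorname{Net}_{GH}(\mathbb{R})$ of all $\varepsilon$-nets in the real line $\mathbb{R}$, equipped with the Gromov–Hausdorff distance, is contractible.
   Context: $\mathbb{R}$ carries its standard metric $|x-y|$, and subsets of $\mathbb{R}$ carry the induced metric. An $\varepsilon$-net in $\mathbb{R}$ is a non-empty subset $A\subset\mathbb{R}$ such that every point of $\mathbb{R}$ is at distance at most $\varepsilon$ from some point of $A$; "the space of all $\varepsilon$-nets" means the set of all subsets that are $\varepsilon$-nets for some $\varepsilon>0$ (with $\varepsilon$ depending on the subset), i.e. all non-empty $A\subset\mathbb{R}$ at finite Hausdorff distance from $\mathbb{R}$. The Gromov–Hausdorff distance $d_{GH}(X,Y)$ between non-empty metric spaces $X,Y$ is the infimum of the numbers $r\ge 0$ for which there exist a metric space $Z$ and subsets $X',Y'\subset Z$ isometric to $X$ and $Y$ respectively with Hausdorff distance $d_H(X',Y')\le r$. Equivalently, $2d_{GH}(X,Y)=\inf\{\operatorname{dis} R\}$ over all correspondences $R\subset X\times Y$ (relations projecting surjectively onto both factors), where $\operatorname{dis}R=\sup\{\,\bigl||xx'|-|yy'|\bigr| : (x,y),(x',y')\in R\}$. On $\operatorname{Net}_{GH}(\mathbb{R})$ the function $d_{GH}$ is a finite pseudometric, and the space carries the topology it induces; contractible means that the identity map is homotopic to a constant map. *)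

theory Defs
  imports "HOL-Analysis.Analysis"
begin

definition hausdorff_dist :: "('z \<Rightarrow> 'z \<Rightarrow> real) \<Rightarrow> 'z set \<Rightarrow> 'z set \<Rightarrow> ereal" where
  "hausdorff_dist d A B =
     max (SUP a\<in>A. INF b\<in>B. ereal (d a b)) (SUP b\<in>B. INF a\<in>A. ereal (d a b))"

definition isometric_copy ::
    "('z \<Rightarrow> 'z \<Rightarrow> real) \<Rightarrow> 'a::metric_space set \<Rightarrow> 'z set \<Rightarrow> bool" where
  "isometric_copy d X X' \<longleftrightarrow>
     (\<exists>f. bij_betw f X X' \<and> (\<forall>x\<in>X. \<forall>y\<in>X. d (f x) (f y) = dist x y))"

definition gh_realizes ::
    "'z set \<Rightarrow> ('z \<Rightarrow> 'z \<Rightarrow> real) \<Rightarrow> 'a::metric_space set \<Rightarrow> 'b::metric_space set \<Rightarrow> real \<Rightarrow> bool" where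
  "gh_realizes Z d X Y r \<longleftrightarrow> Metric_space Z d \<and>
     (\<exists>X' Y'. X' \<subseteq> Z \<and> Y' \<subseteq> Z \<and> isometric_copy d X X' \<and> isometric_copy d Y Y' \<and>
        hausdorff_dist d X' Y' \<le> ereal r)"

text \<open>
  The ambient metric spaces below have carriers inside the type \<^typ>\<open>'a + 'b\<close>. This loses no
  generality: by \<open>gh_realizes_sum_type\<close>, whatever is realized in a metric space over an arbitrary
  type is realized in one of these.
\<close>

definition gh_dist :: "'a::metric_space set \<Rightarrow> 'b::metric_space set \<Rightarrow> ereal" where
  "gh_dist X Y =
     Inf {ereal r | r. 0 \<le> r \<and> (\<exists>(Z :: ('a + 'b) set) d. gh_realizes Z d X Y r)}"

lemma gh_realizes_sum_type:
  fixes X :: "'a::metric_space set" and Y :: "'b::metric_space set" and Z :: "'z set"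
  assumes "gh_realizes Z d X Y r"
  shows "\<exists>(Z' :: ('a + 'b) set) d'. gh_realizes Z' d' X Y r"
proof -
  obtain X' Y' f g where Z: "Metric_space Z d" and sub: "X' \<subseteq> Z" "Y' \<subseteq> Z"
    and f: "bij_betw f X X'" "\<forall>x\<in>X. \<forall>y\<in>X. d (f x) (f y) = dist x y"
    and g: "bij_betw g Y Y'" "\<forall>x\<in>Y. \<forall>y\<in>Y. d (g x) (g y) = dist x y"
    and le: "hausdorff_dist d X' Y' \<le> ereal r"
    using assms unfolding gh_realizes_def isometric_copy_def by blast
  define k where "k = case_sum f g"
  define h where "h z = (if z \<in> X' then Inl (inv_into X f z) else Inr (inv_into Y g z))" for z
  have kh: "k (h z) = z" if "z \<in> X' \<union> Y'" for z
    using that f(1) g(1) unfolding k_def h_def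
    by (auto simp: bij_betw_def f_inv_into_f)
  define d' where "d' u v = d (k u) (k v)" for u v
  have inj: "inj_on h (X' \<union> Y')"
    using kh by (metis inj_onI)
  interpret Z: Metric_space Z d by (fact Z)
  have M: "Metric_space (h ` (X' \<union> Y')) d'"
  proof
    fix x y show "0 \<le> d' x y" by (simp add: d'_def)
  next
    fix x y show "d' x y = d' y x" by (simp add: d'_def Z.commute)
  next
    fix x y assume "x \<in> h ` (X' \<union> Y')" "y \<in> h ` (X' \<union> Y')"
    then obtain a b where ab: "a \<in> X' \<union> Y'" "b \<in> X' \<union> Y'" "x = h a" "y = h b" by blast
    then have "d' x y = d a b" "x = y \<longleftrightarrow> a = b"
      using kh[of a] kh[of b] by (simp add: d'_def, metis)
    moreover have "a \<in> Z" "b \<in> Z" using ab sub by blast+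
    ultimately show "d' x y = 0 \<longleftrightarrow> x = y" by simp
  next
    fix x y z
    assume "x \<in> h ` (X' \<union> Y')" "y \<in> h ` (X' \<union> Y')" "z \<in> h ` (X' \<union> Y')"
    then have "k x \<in> Z" "k y \<in> Z" "k z \<in> Z" using kh sub by (auto simp: image_iff)
    then show "d' x z \<le> d' x y + d' y z" by (simp add: d'_def Z.triangle)
  qed
  have "isometric_copy d' X (h ` X')"
    unfolding isometric_copy_def
  proof (intro exI conjI ballI)
    show "bij_betw (h \<circ> f) X (h ` X')"
      using f(1) inj by (meson bij_betw_trans inj_on_imp_bij_betw inj_on_subset sup_ge1)
    fix x y assume xy: "x \<in> X" "y \<in> X"
    then have "f x \<in> X'" "f y \<in> X'" using bij_betwE[OF f(1)] by blast+
    then show "d' ((h \<circ> f) x) ((h \<circ> f) y) = dist x y"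
      using f(2) kh xy by (simp add: d'_def)
  qed
  moreover have "isometric_copy d' Y (h ` Y')"
    unfolding isometric_copy_def
  proof (intro exI conjI ballI)
    show "bij_betw (h \<circ> g) Y (h ` Y')"
      using g(1) inj by (meson bij_betw_trans inj_on_imp_bij_betw inj_on_subset sup_ge2)
    fix x y assume xy: "x \<in> Y" "y \<in> Y"
    then have "g x \<in> Y'" "g y \<in> Y'" using bij_betwE[OF g(1)] by blast+
    then show "d' ((h \<circ> g) x) ((h \<circ> g) y) = dist x y"
      using g(2) kh xy by (simp add: d'_def)
  qed
  moreover have "hausdorff_dist d' (h ` X') (h ` Y') = hausdorff_dist d X' Y'"
    unfolding hausdorff_dist_def image_image d'_def
    by (intro arg_cong2[of _ _ _ _ max] SUP_cong INF_cong refl) (simp_all add: kh)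
  ultimately have "gh_realizes (h ` (X' \<union> Y')) d' X Y r"
    using M le unfolding gh_realizes_def by (metis image_mono sup_ge1 sup_ge2)
  then show ?thesis by blast
qed

definition eps_net :: "real \<Rightarrow> real set \<Rightarrow> bool" where
  "eps_net \<epsilon> A \<longleftrightarrow> A \<noteq> {} \<and> (\<forall>x. \<exists>a\<in>A. dist x a \<le> \<epsilon>)"

definition nets :: "real set set" where
  "nets = {A. \<exists>\<epsilon>>0. eps_net \<epsilon> A}"

text \<open>
  The topology on \<open>S\<close> induced by a distance function \<open>\<delta>\<close>; distinct points may be at distance
  zero, so \<^locale>\<open>Metric_space\<close> does not apply.
\<close>

definition dist_topology :: "'s set \<Rightarrow> ('s \<Rightarrow> 's \<Rightarrow> ereal) \<Rightarrow> 's topology" where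
  "dist_topology S \<delta> =
     topology (\<lambda>U. U \<subseteq> S \<and> (\<forall>x\<in>U. \<exists>r>0. \<forall>y\<in>S. \<delta> x y < ereal r \<longrightarrow> y \<in> U))"

lemma openin_dist_topology:
  "openin (dist_topology S \<delta>) U \<longleftrightarrow>
     U \<subseteq> S \<and> (\<forall>x\<in>U. \<exists>r>0. \<forall>y\<in>S. \<delta> x y < ereal r \<longrightarrow> y \<in> U)"
proof -
  let ?op = "\<lambda>U. U \<subseteq> S \<and> (\<forall>x\<in>U. \<exists>r>0. \<forall>y\<in>S. \<delta> x y < ereal r \<longrightarrow> y \<in> U)"
  have "?op (U \<inter> V)" if U: "?op U" and V: "?op V" for U V
  proof (intro conjI ballI)
    show "U \<inter> V \<subseteq> S" using U by blast
    fix x assume x: "x \<in> U \<inter> V"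
    obtain r where r: "r > 0" "\<forall>y\<in>S. \<delta> x y < ereal r \<longrightarrow> y \<in> U" using U x by blast
    obtain s where s: "s > 0" "\<forall>y\<in>S. \<delta> x y < ereal s \<longrightarrow> y \<in> V" using V x by blast
    have "\<forall>y\<in>S. \<delta> x y < ereal (min r s) \<longrightarrow> y \<in> U \<inter> V"
      using r(2) s(2)
      by (metis IntI ereal_less_eq(3) less_le_trans min.cobounded1 min.cobounded2)
    then show "\<exists>r>0. \<forall>y\<in>S. \<delta> x y < ereal r \<longrightarrow> y \<in> U \<inter> V"
      using r(1) s(1) by (intro exI[of _ "min r s"]) simp
  qed
  moreover have "?op (\<Union>K)" if "\<forall>U\<in>K. ?op U" for K
    using that by (intro conjI ballI) (blast, meson UnionE UnionI)
  ultimately have "istopology ?op"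
    unfolding istopology_def by blast
  then show ?thesis
    by (simp add: dist_topology_def topology_inverse')
qed

lemma topspace_dist_topology [simp]: "topspace (dist_topology S \<delta>) = S"
proof -
  have "openin (dist_topology S \<delta>) S"
    by (auto simp: openin_dist_topology intro: exI[of _ 1])
  then show ?thesis
    by (meson openin_dist_topology openin_subset openin_topspace subset_antisym)
qed

definition Net_GH :: "real set topology" where
  "Net_GH = dist_topology nets gh_dist"

end

theory Submission
  imports Defs
begin

text \<open>
  A correspondence of distortion \<open>c\<close> between subsets of the line lies within \<open>6c\<close> of an isometry
  \<open>y \<mapsto> \<sigma> * y + \<tau>\<close> of the line. Hence \<open>gh_dist\<close> is equivalent to the Hausdorff distance
  up to isometries, and for the latter the map sending \<open>A\<close> to its closed \<open>s\<close>-neighbourhood is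
  \<open>1\<close>-Lipschitz both in \<open>A\<close> and in \<open>s\<close>. Letting \<open>s\<close> run from \<open>0\<close> to infinity contracts the space
  of nets to the line itself: near an \<open>\<epsilon>\<close>-net all neighbourhoods with \<open>s \<ge> \<epsilon> + 1\<close> are the whole line.
\<close>

section \<open>Closeness up to isometries of the line\<close>

text \<open>Each bound is attained by an actual point, unlike the infima in
  \<open>hausdorff_dist\<close>, so estimates compose by choosing points.\<close>

definition iso_close :: "real \<Rightarrow> real set \<Rightarrow> real set \<Rightarrow> bool" where
  "iso_close r X Y \<longleftrightarrow>
     (\<exists>\<sigma> \<tau>. \<bar>\<sigma>\<bar> = 1 \<and> (\<forall>x\<in>X. \<exists>y\<in>Y. \<bar>x - (\<sigma> * y + \<tau>)\<bar> \<le> r) \<and>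
            (\<forall>y\<in>Y. \<exists>x\<in>X. \<bar>x - (\<sigma> * y + \<tau>)\<bar> \<le> r))"

definition thicken :: "real \<Rightarrow> real set \<Rightarrow> real set" where
  "thicken s A = {x. \<exists>a\<in>A. \<bar>x - a\<bar> \<le> s}"

lemma iso_close_refl: "0 \<le> r \<Longrightarrow> iso_close r X X"
  unfolding iso_close_def by (rule exI[of _ 1], rule exI[of _ 0]) force

lemma iso_close_nonneg: "iso_close r X Y \<Longrightarrow> X \<noteq> {} \<Longrightarrow> 0 \<le> r"
  unfolding iso_close_def by (meson abs_ge_zero all_not_in_conv order_trans)

lemma iso_close_trans:
  assumes "iso_close r X Y" "iso_close s Y Z"
  shows "iso_close (r + s) X Z"
proof -
  obtain \<sigma> \<tau> where \<sigma>: "\<bar>\<sigma>\<bar> = 1"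
    and XY: "\<forall>x\<in>X. \<exists>y\<in>Y. \<bar>x - (\<sigma> * y + \<tau>)\<bar> \<le> r" "\<forall>y\<in>Y. \<exists>x\<in>X. \<bar>x - (\<sigma> * y + \<tau>)\<bar> \<le> r"
    using assms(1) unfolding iso_close_def by blast
  obtain \<sigma>' \<tau>' where \<sigma>': "\<bar>\<sigma>'\<bar> = 1"
    and YZ: "\<forall>y\<in>Y. \<exists>z\<in>Z. \<bar>y - (\<sigma>' * z + \<tau>')\<bar> \<le> s" "\<forall>z\<in>Z. \<exists>y\<in>Y. \<bar>y - (\<sigma>' * z + \<tau>')\<bar> \<le> s"
    using assms(2) unfolding iso_close_def by blast
  have step: "\<bar>x - (\<sigma> * \<sigma>' * z + (\<sigma> * \<tau>' + \<tau>))\<bar> \<le> r + s"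
    if "\<bar>x - (\<sigma> * y + \<tau>)\<bar> \<le> r" "\<bar>y - (\<sigma>' * z + \<tau>')\<bar> \<le> s" for x y z
  proof -
    have "\<bar>\<sigma> * (y - (\<sigma>' * z + \<tau>'))\<bar> \<le> s"
      using that(2) \<sigma> by (simp add: abs_mult)
    moreover have "x - (\<sigma> * \<sigma>' * z + (\<sigma> * \<tau>' + \<tau>)) =
        (x - (\<sigma> * y + \<tau>)) + \<sigma> * (y - (\<sigma>' * z + \<tau>'))"
      by (simp add: algebra_simps)
    ultimately show ?thesis using that(1) by linarith
  qed
  have "\<bar>\<sigma> * \<sigma>'\<bar> = 1" using \<sigma> \<sigma>' by (simp add: abs_mult)
  moreover have "\<forall>x\<in>X. \<exists>z\<in>Z. \<bar>x - (\<sigma> * \<sigma>' * z + (\<sigma> * \<tau>' + \<tau>))\<bar> \<le> r + s"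
    using XY(1) YZ(1) step by blast
  moreover have "\<forall>z\<in>Z. \<exists>x\<in>X. \<bar>x - (\<sigma> * \<sigma>' * z + (\<sigma> * \<tau>' + \<tau>))\<bar> \<le> r + s"
    using XY(2) YZ(2) step by blast
  ultimately show ?thesis unfolding iso_close_def by blast
qed

text \<open>The line itself serves as the common metric space, containing \<open>X\<close> and the
  image of \<open>Y\<close> under the isometry.\<close>

lemma gh_dist_le_iso_close:
  assumes "iso_close r X Y" "0 \<le> r"
  shows "gh_dist X Y \<le> ereal r"
proof -
  obtain \<sigma> \<tau> where \<sigma>: "\<bar>\<sigma>\<bar> = 1"
    and XY: "\<forall>x\<in>X. \<exists>y\<in>Y. \<bar>x - (\<sigma> * y + \<tau>)\<bar> \<le> r" "\<forall>y\<in>Y. \<exists>x\<in>X. \<bar>x - (\<sigma> * y + \<tau>)\<bar> \<le> r"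
    using assms(1) unfolding iso_close_def by blast
  define g where "g y = \<sigma> * y + \<tau>" for y
  have "dist (g x) (g y) = dist x y" for x y
  proof -
    have "g x - g y = \<sigma> * (x - y)" by (simp add: g_def algebra_simps)
    then show ?thesis using \<sigma> by (simp add: dist_real_def abs_mult)
  qed
  then have g: "isometric_copy dist Y (g ` Y)"
    unfolding isometric_copy_def
    by (intro exI[of _ g]) (auto simp: bij_betw_def inj_on_def, metis dist_eq_0_iff)
  have id: "isometric_copy dist X X"
    unfolding isometric_copy_def by (intro exI[of _ id]) auto
  have "(SUP x\<in>X. INF y\<in>g ` Y. ereal (dist x y)) \<le> ereal r"
  proof (intro SUP_least)
    fix x assume "x \<in> X"
    then obtain y where "y \<in> Y" "dist x (g y) \<le> r"
      using XY(1) by (auto simp: g_def dist_real_def)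
    then show "(INF z\<in>g ` Y. ereal (dist x z)) \<le> ereal r" by (auto intro: INF_lower2)
  qed
  moreover have "(SUP y\<in>g ` Y. INF x\<in>X. ereal (dist x y)) \<le> ereal r"
  proof (intro SUP_least)
    fix z assume "z \<in> g ` Y"
    then obtain x where "x \<in> X" "dist x z \<le> r"
      using XY(2) by (auto simp: g_def dist_real_def)
    then show "(INF x\<in>X. ereal (dist x z)) \<le> ereal r" by (auto intro: INF_lower2)
  qed
  ultimately have "hausdorff_dist dist X (g ` Y) \<le> ereal r"
    by (simp add: hausdorff_dist_def)
  then have "gh_realizes (UNIV :: real set) dist X Y r"
    using g id Met_TC.Metric_space_axioms unfolding gh_realizes_def by blast
  from gh_realizes_sum_type[OF this] assms(2) show ?thesis
    unfolding gh_dist_def by (intro Inf_lower) blast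
qed

section \<open>Correspondences of small distortion in the line\<close>

text \<open>All numbers are coordinates relative to a base pair. The distance to the base point
  fixes a point up to sign; the distance to a second, far reference pair \<open>p1\<close>,
  \<open>q1\<close> fixes the sign.\<close>

lemma abs_distortion_sgn_bound:
  fixes p q p1 q1 c :: real
  assumes "\<bar>\<bar>p\<bar> - \<bar>q\<bar>\<bar> \<le> c" "\<bar>\<bar>p1\<bar> - \<bar>q1\<bar>\<bar> \<le> c" "\<bar>\<bar>p - p1\<bar> - \<bar>q - q1\<bar>\<bar> \<le> c"
    and large: "5/2 * c < \<bar>p1\<bar>"
  shows "\<bar>p - sgn (p1 * q1) * q\<bar> \<le> 6 * c"
proof -
  \<comment> \<open>If \<open>x\<close> and \<open>y\<close> have the same sign, the first
    hypothesis suffices. Otherwise, if the nonnegative one does not exceed its reference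
    \<open>u\<close> or \<open>v\<close>, comparing distances to the references gives
    \<open>\<bar>x\<bar> + \<bar>y\<bar> \<le> 2 * c\<close>; if it does,
    \<open>u + v \<le> 2 * c\<close> follows, against the size of \<open>u\<close>.\<close>
  have pos: "\<bar>x - y\<bar> \<le> 6 * c"
    if "\<bar>\<bar>x\<bar> - \<bar>y\<bar>\<bar> \<le> c" "\<bar>u - v\<bar> \<le> c" "\<bar>\<bar>x - u\<bar> - \<bar>y - v\<bar>\<bar> \<le> c"
      "5/2 * c < u" "0 < v" for x y u v :: real
  proof (cases "0 \<le> x"; cases "0 \<le> y")
    assume "0 \<le> x" "\<not> 0 \<le> y"
    then show ?thesis using that by (cases "x \<le> u") auto
  next
    assume "\<not> 0 \<le> x" "0 \<le> y"
    then show ?thesis using that by (cases "y \<le> v") auto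
  qed (use that in auto)
  have "c \<ge> 0" using assms(1) by linarith
  \<comment> \<open>\<open>q1\<close> cannot vanish, since
    \<open>\<bar>q1\<bar> \<ge> \<bar>p1\<bar> - c > 3/2 * c\<close>. Reflecting either line reduces
    each sign pattern to \<open>pos\<close>.\<close>
  then consider "0 < p1" "0 < q1" | "0 < p1" "q1 < 0" | "p1 < 0" "0 < q1" | "p1 < 0" "q1 < 0"
    using assms(2) large by linarith
  then show ?thesis
  proof cases
    case 1
    then show ?thesis using pos[of p q p1 q1] assms by (simp add: sgn_mult)
  next
    case 2
    then show ?thesis using pos[of p "- q" p1 "- q1"] assms by (simp add: sgn_mult abs_minus_commute)
  next
    case 3
    then show ?thesis using pos[of "- p" q "- p1" q1] assms by (simp add: sgn_mult abs_minus_commute)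
  next
    case 4
    then show ?thesis using pos[of "- p" "- q" "- p1" "- q1"] assms by (simp add: sgn_mult abs_minus_commute)
  qed
qed

text \<open>Fix a base pair. If all first coordinates stay near it, a translation is good enough;
  otherwise a far pair determines the orientation \<open>\<sigma>\<close>.\<close>

lemma real_correspondence_near_isometry:
  fixes R :: "(real \<times> real) set"
  assumes dis: "\<And>a b a' b'. (a, b) \<in> R \<Longrightarrow> (a', b') \<in> R \<Longrightarrow> \<bar>\<bar>a - a'\<bar> - \<bar>b - b'\<bar>\<bar> \<le> c"
  shows "\<exists>\<sigma> \<tau>. \<bar>\<sigma>\<bar> = 1 \<and> (\<forall>(a, b)\<in>R. \<bar>a - (\<sigma> * b + \<tau>)\<bar> \<le> 6 * c)"
proof (cases "R = {}")
  case True
  then show ?thesis by (intro exI[of _ 1]) auto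
next
  case False
  then obtain a0 b0 where 0: "(a0, b0) \<in> R" by auto
  have "c \<ge> 0" using dis[OF 0 0] by simp
  show ?thesis
  proof (cases "\<forall>(a, b)\<in>R. \<bar>a - a0\<bar> \<le> 5/2 * c")
    case True
    have "\<bar>a - (1 * b + (a0 - b0))\<bar> \<le> 6 * c" if "(a, b) \<in> R" for a b
    proof -
      \<comment> \<open>The distortion gives \<open>\<bar>b - b0\<bar> \<le> 7/2 * c\<close>, and
        5/2 + 7/2 = 6.\<close>
      have "\<bar>a - a0\<bar> \<le> 5/2 * c" using True that by blast
      then show ?thesis using dis[OF that 0] \<open>c \<ge> 0\<close> by argo
    qed
    then show ?thesis by (intro exI[of _ 1] exI[of _ "a0 - b0"]) auto
  next
    case False
    then obtain a1 b1 where 1: "(a1, b1) \<in> R" "\<bar>a1 - a0\<bar> > 5/2 * c" by auto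
    define \<sigma> where "\<sigma> = sgn ((a1 - a0) * (b1 - b0))"
    have \<sigma>: "\<bar>\<sigma>\<bar> = 1"
      using 1 dis[OF 1(1) 0] \<open>c \<ge> 0\<close> by (auto simp: \<sigma>_def abs_sgn_eq)
    have "\<bar>a - (\<sigma> * b + (a0 - \<sigma> * b0))\<bar> \<le> 6 * c" if "(a, b) \<in> R" for a b
      using abs_distortion_sgn_bound[of "a - a0" "b - b0" c "a1 - a0" "b1 - b0"]
        dis[OF that 0] dis[OF 1(1) 0] dis[OF that 1(1)] 1(2)
      by (simp add: \<sigma>_def algebra_simps)
    then show ?thesis
      using \<sigma> by (intro exI[of _ \<sigma>] exI[of _ "a0 - \<sigma> * b0"]) auto
  qed
qed

text \<open>Pairs at distance below \<open>r\<close> in a common metric space form a correspondence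
  of distortion at most \<open>2 * r\<close>; the preceding lemma multiplies this by 6.\<close>

lemma iso_close_gh_dist:
  fixes X Y :: "real set"
  assumes "gh_dist X Y < ereal r"
  shows "iso_close (12 * r) X Y"
proof -
  obtain q Z d where "q < r" and "gh_realizes (Z :: (real + real) set) d X Y q"
    using assms unfolding gh_dist_def Inf_less_iff by auto
  then obtain X' Y' f g where Z: "Metric_space Z d" and sub: "X' \<subseteq> Z" "Y' \<subseteq> Z"
    and f: "bij_betw f X X'" "\<forall>x\<in>X. \<forall>y\<in>X. d (f x) (f y) = dist x y"
    and g: "bij_betw g Y Y'" "\<forall>x\<in>Y. \<forall>y\<in>Y. d (g x) (g y) = dist x y"
    and le: "hausdorff_dist d X' Y' \<le> ereal q"
    unfolding gh_realizes_def isometric_copy_def by blast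
  interpret Z: Metric_space Z d by (fact Z)
  have im: "X' = f ` X" "Y' = g ` Y" using f(1) g(1) by (auto simp: bij_betw_def)
  \<comment> \<open>The gap between \<open>q\<close> and \<open>r\<close> turns the infima into
    actual points at distance less than \<open>r\<close>.\<close>
  have "(SUP a\<in>X'. INF b\<in>Y'. ereal (d a b)) < ereal r"
    "(SUP b\<in>Y'. INF a\<in>X'. ereal (d a b)) < ereal r"
    using le \<open>q < r\<close> unfolding hausdorff_dist_def
    by (meson ereal_less_le less_ereal.simps(1) max.boundedE order_le_less_trans)+
  then have "\<forall>a\<in>X'. (INF b\<in>Y'. ereal (d a b)) < ereal r"
    "\<forall>b\<in>Y'. (INF a\<in>X'. ereal (d a b)) < ereal r"
    by (meson SUP_lessD)+
  then have XY: "\<forall>x\<in>X. \<exists>y\<in>Y. d (f x) (g y) < r" "\<forall>y\<in>Y. \<exists>x\<in>X. d (f x) (g y) < r"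
    unfolding INF_less_iff im by auto
  define R where "R = {(x, y). x \<in> X \<and> y \<in> Y \<and> d (f x) (g y) < r}"
  have "\<bar>\<bar>x - x'\<bar> - \<bar>y - y'\<bar>\<bar> \<le> 2 * r" if "(x, y) \<in> R" "(x', y') \<in> R" for x y x' y'
  proof -
    have in_Z: "f x \<in> Z" "f x' \<in> Z" "g y \<in> Z" "g y' \<in> Z"
      and lt: "d (f x) (g y) < r" "d (f x') (g y') < r"
      using that sub im by (auto simp: R_def)
    have "d (f x) (f x') = \<bar>x - x'\<bar>" "d (g y) (g y') = \<bar>y - y'\<bar>"
      using that f(2) g(2) by (auto simp: R_def dist_real_def)
    moreover have "d (f x) (f x') \<le> d (f x) (g y) + d (g y) (g y') + d (f x') (g y')"
      "d (g y) (g y') \<le> d (f x) (g y) + d (f x) (f x') + d (f x') (g y')"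
      using in_Z Z.triangle Z.commute by (smt (verit))+
    ultimately show ?thesis using lt by linarith
  qed
  from real_correspondence_near_isometry[of R, OF this] obtain \<sigma> \<tau> where
    "\<bar>\<sigma>\<bar> = 1" "\<forall>(x, y)\<in>R. \<bar>x - (\<sigma> * y + \<tau>)\<bar> \<le> 12 * r"
    by auto
  then show ?thesis
    using XY unfolding iso_close_def R_def
    by (intro exI[of _ \<sigma>] exI[of _ \<tau>]) fast
qed

section \<open>Neighbourhoods of sets and nets\<close>

lemma clamp_near:
  fixes s s' u :: real
  assumes "\<bar>u\<bar> \<le> s" "0 \<le> s'"
  obtains w where "\<bar>w\<bar> \<le> s'" "\<bar>u - w\<bar> \<le> \<bar>s - s'\<bar>"
proof
  show "\<bar>max (- s') (min s' u)\<bar> \<le> s'" "\<bar>u - max (- s') (min s' u)\<bar> \<le> \<bar>s - s'\<bar>"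
    using assms by (auto simp: max_def min_def)
qed

text \<open>The same isometry works: a point of a neighbourhood is a point of the set plus an
  offset, and the offset is carried over to the partner point after being clamped to the new
  radius.\<close>

lemma iso_close_thicken:
  assumes "iso_close r X Y" "0 \<le> s" "0 \<le> s'"
  shows "iso_close (r + \<bar>s - s'\<bar>) (thicken s X) (thicken s' Y)"
proof -
  obtain \<sigma> \<tau> where \<sigma>: "\<bar>\<sigma>\<bar> = 1"
    and XY: "\<forall>x\<in>X. \<exists>y\<in>Y. \<bar>x - (\<sigma> * y + \<tau>)\<bar> \<le> r" "\<forall>y\<in>Y. \<exists>x\<in>X. \<bar>x - (\<sigma> * y + \<tau>)\<bar> \<le> r"
    using assms(1) unfolding iso_close_def by blast
  have \<sigma>\<sigma>: "\<sigma> * \<sigma> = 1" using \<sigma> by (metis abs_mult_self_eq mult_1)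
  have "\<exists>v\<in>thicken s' Y. \<bar>u - (\<sigma> * v + \<tau>)\<bar> \<le> r + \<bar>s - s'\<bar>" if u: "u \<in> thicken s X" for u
  proof -
    obtain x where x: "x \<in> X" "\<bar>u - x\<bar> \<le> s" using u by (auto simp: thicken_def)
    obtain y where y: "y \<in> Y" "\<bar>x - (\<sigma> * y + \<tau>)\<bar> \<le> r" using XY x by blast
    obtain w where w: "\<bar>w\<bar> \<le> s'" "\<bar>(u - x) - w\<bar> \<le> \<bar>s - s'\<bar>"
      using clamp_near[OF x(2) assms(3)] .
    \<comment> \<open>As \<open>\<sigma>\<close> is its own inverse, the isometry turns the offset
      \<open>\<sigma> * w\<close> at \<open>y\<close> into the offset \<open>w\<close>.\<close>
    have "y + \<sigma> * w \<in> thicken s' Y"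
      using y w \<sigma> by (auto simp: thicken_def abs_mult intro!: bexI[of _ y])
    moreover have "\<sigma> * (y + \<sigma> * w) = \<sigma> * y + w"
      using \<sigma>\<sigma> by (simp add: distrib_left flip: mult.assoc)
    ultimately show ?thesis
      using y w by (intro bexI[of _ "y + \<sigma> * w"]) auto
  qed
  moreover have "\<exists>u\<in>thicken s X. \<bar>u - (\<sigma> * v + \<tau>)\<bar> \<le> r + \<bar>s - s'\<bar>" if v: "v \<in> thicken s' Y" for v
  proof -
    obtain y where y: "y \<in> Y" "\<bar>v - y\<bar> \<le> s'" using v by (auto simp: thicken_def)
    obtain x where x: "x \<in> X" "\<bar>x - (\<sigma> * y + \<tau>)\<bar> \<le> r" using XY y by blast
    have "\<bar>\<sigma> * (v - y)\<bar> \<le> s'" using y \<sigma> by (simp add: abs_mult)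
    then obtain w where w: "\<bar>w\<bar> \<le> s" "\<bar>\<sigma> * (v - y) - w\<bar> \<le> \<bar>s' - s\<bar>"
      using clamp_near[OF _ assms(2)] by blast
    have "x + w \<in> thicken s X"
      using x w by (auto simp: thicken_def intro!: bexI[of _ x])
    moreover have "\<bar>x + w - (\<sigma> * v + \<tau>)\<bar> \<le> r + \<bar>s - s'\<bar>"
      using x(2) w(2) unfolding right_diff_distrib by linarith
    ultimately show ?thesis by blast
  qed
  ultimately show ?thesis unfolding iso_close_def using \<sigma> by blast
qed

text \<open>Map a point by the isometry, approximate it in \<open>X\<close>, pass to a partner in
  \<open>Y\<close> and pull back. This makes one radius suffice for all nets near a given
  one.\<close>

lemma eps_net_iso_close:
  assumes "iso_close r X Y" "eps_net \<epsilon> X"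
  shows "eps_net (\<epsilon> + r) Y"
proof -
  obtain \<sigma> \<tau> where \<sigma>: "\<bar>\<sigma>\<bar> = 1"
    and XY: "\<forall>x\<in>X. \<exists>y\<in>Y. \<bar>x - (\<sigma> * y + \<tau>)\<bar> \<le> r"
    using assms(1) unfolding iso_close_def by blast
  have "\<exists>y\<in>Y. dist v y \<le> \<epsilon> + r" for v
  proof -
    obtain x where x: "x \<in> X" "\<bar>\<sigma> * v + \<tau> - x\<bar> \<le> \<epsilon>"
      using assms(2) unfolding eps_net_def dist_real_def by blast
    obtain y where y: "y \<in> Y" "\<bar>x - (\<sigma> * y + \<tau>)\<bar> \<le> r" using XY x by blast
    have "\<bar>\<sigma> * (v - y)\<bar> \<le> \<epsilon> + r"
      using x y unfolding right_diff_distrib by linarith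
    then show ?thesis using \<sigma> y by (auto simp: abs_mult dist_real_def)
  qed
  then show ?thesis unfolding eps_net_def by blast
qed

lemma thicken_0 [simp]: "thicken 0 A = A"
  by (auto simp: thicken_def)

lemma thicken_eps_net: "eps_net \<epsilon> A \<Longrightarrow> \<epsilon> \<le> s \<Longrightarrow> thicken s A = UNIV"
  unfolding thicken_def eps_net_def dist_real_def using order_trans by blast

lemma thicken_nets:
  assumes "A \<in> nets" "0 \<le> s"
  shows "thicken s A \<in> nets"
proof -
  have "A \<subseteq> thicken s A" using assms(2) unfolding thicken_def by force
  then show ?thesis using assms(1) unfolding nets_def eps_net_def by blast
qed

lemma UNIV_nets: "UNIV \<in> nets"
  unfolding nets_def eps_net_def mem_Collect_eq
  by (metis UNIV_I dist_self empty_iff zero_le_one zero_less_one)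

text \<open>These are the neighbourhoods used for continuity of the contraction. The strict
  \<open>\<rho> < r\<close> leaves the room that openness needs.\<close>

lemma openin_Net_GH_iso_ball:
  "openin Net_GH {B \<in> nets. \<exists>\<rho><r. iso_close \<rho> A B}"
  unfolding Net_GH_def openin_dist_topology
proof (intro conjI ballI)
  fix B assume "B \<in> {B \<in> nets. \<exists>\<rho><r. iso_close \<rho> A B}"
  then obtain \<rho> where \<rho>: "\<rho> < r" "iso_close \<rho> A B" by blast
  \<comment> \<open>Passing from \<open>gh_dist\<close> to \<open>iso_close\<close> costs a factor
    12, so 24 uses up half of the gap \<open>r - \<rho>\<close>.\<close>
  have "\<exists>\<rho><r. iso_close \<rho> A C" if "gh_dist B C < ereal ((r - \<rho>) / 24)" for C
  proof (intro exI conjI)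
    show "iso_close (\<rho> + 12 * ((r - \<rho>) / 24)) A C"
      using iso_close_trans[OF \<rho>(2) iso_close_gh_dist[OF that]] .
    show "\<rho> + 12 * ((r - \<rho>) / 24) < r" using \<rho>(1) by (simp add: field_simps)
  qed
  then show "\<exists>\<delta>>0. \<forall>C\<in>nets. gh_dist B C < ereal \<delta> \<longrightarrow> C \<in> {B \<in> nets. \<exists>\<rho><r. iso_close \<rho> A B}"
    using \<rho>(1) by (intro exI[of _ "(r - \<rho>) / 24"]) (simp del: ereal_less_eq less_ereal.simps)
qed auto

section \<open>The contracting homotopy\<close>

theorem theorem6:
  shows "contractible_space Net_GH"
proof -
  \<comment> \<open>\<open>s\<close> maps [0,1) increasingly onto the nonnegative reals. At 1
    division by zero would give \<open>s 1 = 0\<close>, so \<open>h\<close> sets the end value to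
    \<open>UNIV\<close> separately.\<close>
  define s :: "real \<Rightarrow> real" where "s t = t / (1 - t)" for t
  define h where "h = (\<lambda>(t, A). if t < 1 then thicken (s t) A else UNIV)"
  have s_nonneg: "0 \<le> s t" if "0 \<le> t" "t < 1" for t using that by (simp add: s_def)
  have top: "topspace Net_GH = nets" by (simp add: Net_GH_def)
  have h_nets: "h (t, A) \<in> nets" if "0 \<le> t" "A \<in> nets" for t A
    using that by (simp add: h_def thicken_nets s_nonneg UNIV_nets)
  have local: "\<exists>V W. openin (top_of_set {0..1}) V \<and> openin Net_GH W \<and> t \<in> V \<and> A \<in> W \<and>
      (\<forall>t'\<in>V. \<forall>B\<in>W. h (t', B) \<in> U)"
    if U: "openin Net_GH U" and t: "t \<in> {0..1}" and A: "A \<in> nets" and hU: "h (t, A) \<in> U" for U t A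
  proof (cases "t < 1")
    case True
    obtain r where r: "r > 0" "\<forall>C\<in>nets. gh_dist (h (t, A)) C < ereal r \<longrightarrow> C \<in> U"
      using U hU unfolding Net_GH_def openin_dist_topology by blast
    have "isCont s t" unfolding s_def using True by (intro continuous_intros) auto
    then obtain \<delta> where \<delta>: "\<delta> > 0" "\<And>t'. dist t' t < \<delta> \<Longrightarrow> dist (s t') (s t) < r / 2"
      unfolding continuous_at_eps_delta using r(1) half_gt_zero by blast
    \<comment> \<open>Half of \<open>r\<close> is spent on the change of radius and half on the
      change of net; excluding 1 keeps \<open>h\<close> a thickening.\<close>
    let ?V = "{0..1} \<inter> (ball t \<delta> \<inter> {..<1})"
    let ?W = "{B \<in> nets. \<exists>\<rho><r / 2. iso_close \<rho> A B}"
    have "h (t', B) \<in> U" if t': "t' \<in> ?V" and B: "B \<in> ?W" for t' B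
    proof -
      obtain \<rho> where \<rho>: "\<rho> < r / 2" "iso_close \<rho> A B" using B by blast
      have "iso_close (\<rho> + \<bar>s t - s t'\<bar>) (h (t, A)) (h (t', B))"
        using \<rho>(2) True t t' by (auto simp: h_def intro!: iso_close_thicken s_nonneg)
      moreover have "\<bar>s t - s t'\<bar> < r / 2"
        using \<delta>(2)[of t'] t' by (simp add: dist_real_def abs_minus_commute)
      moreover have "0 \<le> \<rho>"
        using iso_close_nonneg[OF \<rho>(2)] A by (auto simp: nets_def eps_net_def)
      ultimately have "gh_dist (h (t, A)) (h (t', B)) \<le> ereal (\<rho> + \<bar>s t - s t'\<bar>)"
        and "\<rho> + \<bar>s t - s t'\<bar> < r"
        using gh_dist_le_iso_close \<rho>(1) by auto
      then have "gh_dist (h (t, A)) (h (t', B)) < ereal r"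
        by (simp add: le_less_trans)
      then show ?thesis using r(2) h_nets t' B by simp
    qed
    moreover have "openin (top_of_set {0..1}) ?V" by (intro openin_open_Int) auto
    moreover have "A \<in> ?W" using A half_gt_zero[OF r(1)] iso_close_refl[of 0 A] by blast
    moreover have "t \<in> ?V" using t True \<delta>(1) by simp
    ultimately show ?thesis
      by (intro exI[of _ ?V] exI[of _ ?W] conjI ballI openin_Net_GH_iso_ball)
  next
    case False
    obtain \<epsilon> where \<epsilon>: "\<epsilon> > 0" "eps_net \<epsilon> A" using A by (auto simp: nets_def)
    \<comment> \<open>The bound solves \<open>s t = \<epsilon> + 1\<close>. Every \<open>B\<close>
      in \<open>?W\<close> is an \<open>(\<epsilon> + \<rho>)\<close>-net for some
      \<open>\<rho> < 1\<close>, so \<open>h\<close> is constantly \<open>UNIV\<close> on this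
      neighbourhood.\<close>
    let ?V = "{0..1} \<inter> {(\<epsilon> + 1) / (\<epsilon> + 2)<..}"
    let ?W = "{B \<in> nets. \<exists>\<rho><1. iso_close \<rho> A B}"
    have "h (t', B) \<in> U" if t': "t' \<in> ?V" and B: "B \<in> ?W" for t' B
    proof -
      obtain \<rho> where \<rho>: "\<rho> < 1" "iso_close \<rho> A B" using B by blast
      have "\<epsilon> + \<rho> \<le> s t'" if "t' < 1"
      proof -
        have "\<epsilon> + 1 \<le> s t'"
          using t' \<epsilon>(1) that by (auto simp: s_def field_simps)
        then show ?thesis using \<rho>(1) by simp
      qed
      then have "h (t', B) = UNIV"
        using thicken_eps_net[OF eps_net_iso_close[OF \<rho>(2) \<epsilon>(2)]] by (simp add: h_def)
      then show ?thesis using hU False by (simp add: h_def)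
    qed
    moreover have "openin (top_of_set {0..1}) ?V" by (intro openin_open_Int) auto
    moreover have "A \<in> ?W" using A iso_close_refl[of 0 A] zero_less_one by blast
    moreover have "t \<in> ?V" using t False \<epsilon>(1) by (auto simp: field_simps)
    ultimately show ?thesis
      by (intro exI[of _ ?V] exI[of _ ?W] conjI ballI openin_Net_GH_iso_ball)
  qed
  have "continuous_map (prod_topology (top_of_set {0..1}) Net_GH) Net_GH h"
    unfolding continuous_map_def
  proof (intro conjI allI impI)
    show "h \<in> topspace (prod_topology (top_of_set {0..1}) Net_GH) \<rightarrow> topspace Net_GH"
      using h_nets by (auto simp: top)
  next
    fix U assume "openin Net_GH U"
    then show "openin (prod_topology (top_of_set {0..1}) Net_GH)
        {p \<in> topspace (prod_topology (top_of_set {0..1}) Net_GH). h p \<in> U}"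
      unfolding openin_prod_topology_alt
    proof (intro allI impI)
      fix t A
      assume "(t, A) \<in> {p \<in> topspace (prod_topology (top_of_set {0..1}) Net_GH). h p \<in> U}"
      then obtain V W where VW: "openin (top_of_set {0..1}) V" "openin Net_GH W" "t \<in> V" "A \<in> W"
        "\<forall>t'\<in>V. \<forall>B\<in>W. h (t', B) \<in> U"
        using local[OF \<open>openin Net_GH U\<close>, of t A] by (auto simp: top)
      moreover have "V \<times> W \<subseteq> topspace (prod_topology (top_of_set {0..1}) Net_GH)"
        using openin_subset[OF VW(1)] openin_subset[OF VW(2)] by auto
      ultimately show "\<exists>V W. openin (top_of_set {0..1}) V \<and> openin Net_GH W \<and> t \<in> V \<and> A \<in> W \<and>
          V \<times> W \<subseteq> {p \<in> topspace (prod_topology (top_of_set {0..1}) Net_GH). h p \<in> U}"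
        by (intro exI[of _ V] exI[of _ W]) blast
    qed
  qed
  moreover have "h (0, A) = id A" "h (1, A) = UNIV" for A
    by (simp_all add: h_def s_def)
  ultimately show ?thesis
    unfolding contractible_space_def homotopic_with_def
    by (intro exI[of _ UNIV] exI[of _ h]) simp
qed

end
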